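(* For every even integer $n\ge 4$, there is an odd cover of $K_n^{(3)}$ of size $n/2$.
   Context: $K_n^{(3)}$ denotes the collection of all $3$-element subsets of an $n$-element vertex set. A complete $3$-partite $3$-graph (on this vertex set) is specified by three pairwise disjoint sets $A_1,A_2,A_3$ of vertices, and consists of those $3$-sets that meet every $A_i$. The sets $A_1,A_2,A_3$ need not cover the vertex set. A set of complete $3$-partite $3$-graphs is an odd cover of $K_n^{(3)}$ if each $3$-set is in an odd number of these complete $3$-partite $3$-graphs. Its size is the number of complete $3$-partite $3$-graphs in it. *)

theory Defs
  imports Main "HOL-Library.Ramsey"
begin

(* A 3-graph on V is its set of edges, a subset of nsets V 3 (the 3-element subsets of V). *)

definition tripartite_edges :: "'a set \<Rightarrow> 'a set \<Rightarrow> 'a set \<Rightarrow> 'a set \<Rightarrow> 'a set set" where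
  "tripartite_edges V A1 A2 A3 =
     {e \<in> nsets V 3. e \<inter> A1 \<noteq> {} \<and> e \<inter> A2 \<noteq> {} \<and> e \<inter> A3 \<noteq> {}}"

(* The parts need not cover V, and they are not required to be nonempty. *)

definition complete_tripartite :: "'a set \<Rightarrow> 'a set set \<Rightarrow> bool" where
  "complete_tripartite V G \<longleftrightarrow>
     (\<exists>A1 A2 A3. A1 \<subseteq> V \<and> A2 \<subseteq> V \<and> A3 \<subseteq> V \<and>
        A1 \<inter> A2 = {} \<and> A1 \<inter> A3 = {} \<and> A2 \<inter> A3 = {} \<and>
        G = tripartite_edges V A1 A2 A3)"

definition odd_cover :: "'a set \<Rightarrow> 'a set set set \<Rightarrow> bool" where
  "odd_cover V F \<longleftrightarrow>
     (\<forall>G\<in>F. complete_tripartite V G) \<and>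
     (\<forall>e\<in>nsets V 3. odd (card {G \<in> F. e \<in> G}))"

end

theory Submission
  imports Defs
begin

text \<open>
  Split the vertices into pairs \<open>u\<^sub>j, v\<^sub>j\<close> for \<open>j < n/2\<close>. The \<open>i\<close>-th 3-graph has the parts
  \<open>{u\<^sub>i, v\<^sub>i}\<close>, \<open>{u\<^sub>j | j < i} \<union> {v\<^sub>j | j > i}\<close> and \<open>{v\<^sub>j | j < i} \<union> {u\<^sub>j | j > i}\<close>.
  A triple containing \<open>u\<^sub>a, v\<^sub>a\<close> and a vertex of another pair \<open>c\<close> lies in the \<open>c\<close>-th 3-graph only.
  For a triple with indices \<open>a < b < c\<close> and types \<open>r, s, t \<in> \<int>/2\<close> only the graphs \<open>a, b, c\<close> matter,
  and the number of those containing it is congruent to \<open>(s + t) + (r + t + 1) + (r + s) = 1\<close>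
  modulo 2.
\<close>

text \<open>The labelling \<open>h\<close> encodes the pairing: \<open>h x = (j, True)\<close> says
  that \<open>x\<close> is \<open>u\<^sub>j\<close>, and \<open>(j, False)\<close> that it is
  \<open>v\<^sub>j\<close>.\<close>

definition pair_graph :: "'a set \<Rightarrow> ('a \<Rightarrow> nat \<times> bool) \<Rightarrow> nat \<Rightarrow> 'a set set" where
  "pair_graph V h i = tripartite_edges V
     {x \<in> V. fst (h x) = i}
     {x \<in> V. fst (h x) \<noteq> i \<and> (snd (h x) \<longleftrightarrow> fst (h x) < i)}
     {x \<in> V. fst (h x) \<noteq> i \<and> (snd (h x) \<longleftrightarrow> i < fst (h x))}"

lemma complete_tripartite_pair_graph: "complete_tripartite V (pair_graph V h i)"
  unfolding complete_tripartite_def pair_graph_def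
  by (rule exI, rule exI, rule exI, intro conjI, rule_tac [7] refl) auto

text \<open>Some vertex must have index \<open>i\<close> to meet the first part. The other two then
  have to fall into different parts: on the same side of \<open>i\<close> this means different
  types, on opposite sides equal types.\<close>

lemma triple_in_pair_graph_iff:
  assumes "{x, y, z} \<in> nsets V 3" "h x = (a, r)" "h y = (b, s)" "h z = (c, t)" "a < b" "b < c"
  shows "{x, y, z} \<in> pair_graph V h i \<longleftrightarrow>
    (i = a \<and> s \<noteq> t) \<or> (i = b \<and> r = t) \<or> (i = c \<and> r \<noteq> s)"
proof -
  have "x \<in> V" "y \<in> V" "z \<in> V"
    using assms(1) by (auto simp: nsets_def)
  with assms show ?thesis
    unfolding pair_graph_def tripartite_edges_def by auto
qed

text \<open>For \<open>i = c\<close>, the vertices \<open>x\<close> and \<open>y\<close> are on the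
  same side of \<open>c\<close> with opposite types, so the second and third parts separate them.
  For \<open>i = a\<close>, only \<open>z\<close> is left for two disjoint parts.\<close>

lemma triple_with_pair_in_pair_graph_iff:
  assumes "{x, y, z} \<in> nsets V 3" "h x = (a, s)" "h y = (a, \<not> s)" "h z = (c, t)" "a \<noteq> c"
  shows "{x, y, z} \<in> pair_graph V h i \<longleftrightarrow> i = c"
proof -
  have "x \<in> V" "y \<in> V" "z \<in> V"
    using assms(1) by (auto simp: nsets_def)
  with assms show ?thesis
    unfolding pair_graph_def tripartite_edges_def by (cases s) auto
qed

lemma odd_card_distinct_pairs:
  assumes "{x, y, z} \<in> nsets V 3" "h ` V \<subseteq> {..<k} \<times> UNIV"
    and "fst (h x) < fst (h y)" "fst (h y) < fst (h z)"
  shows "odd (card {i. i < k \<and> {x, y, z} \<in> pair_graph V h i})"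
proof -
  obtain a r b s c t where h: "h x = (a, r)" "h y = (b, s)" "h z = (c, t)"
    by (metis surj_pair)
  have "x \<in> V" "y \<in> V" "z \<in> V"
    using assms(1) by (auto simp: nsets_def)
  then have lt: "a < k" "b < k" "c < k"
    using assms(2) h by force+
  have abc: "a < b" "b < c"
    using assms h by auto
  have "{i. i < k \<and> {x, y, z} \<in> pair_graph V h i}
      = {i. (i = a \<and> s \<noteq> t) \<or> (i = b \<and> r = t) \<or> (i = c \<and> r \<noteq> s)}"
    using triple_in_pair_graph_iff[of x y z V h a r b s c t] assms(1) h abc lt by auto
  also have "\<dots> = (if s \<noteq> t then {a} else {}) \<union> (if r = t then {b} else {}) \<union>
      (if r \<noteq> s then {c} else {})"
    by auto
  also have "odd (card \<dots>)"
    using abc by (cases r; cases s; cases t) auto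
  finally show ?thesis .
qed

lemma odd_card_same_pair:
  assumes "{x, y, z} \<in> nsets V 3" "bij_betw h V ({..<k} \<times> UNIV)" "fst (h x) = fst (h y)"
  shows "odd (card {i. i < k \<and> {x, y, z} \<in> pair_graph V h i})"
proof -
  obtain a r b s c t where h: "h x = (a, r)" "h y = (b, s)" "h z = (c, t)"
    by (metis surj_pair)
  have V: "x \<in> V" "y \<in> V" "z \<in> V"
    using assms(1) by (auto simp: nsets_def)
  have "distinct [x, y, z]"
    using assms(1) by (auto simp: nsets_def card_insert_if split: if_splits)
  then have ne: "h x \<noteq> h y" "h x \<noteq> h z" "h y \<noteq> h z"
    using V assms(2) by (auto simp: bij_betw_def inj_on_def)
  \<comment> \<open>Only two types exist, so by injectivity \<open>x\<close> and \<open>y\<close>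
    use up the index \<open>a\<close>.\<close>
  then have s: "s = (\<not> r)" and ac: "a \<noteq> c" and ba: "b = a"
    using h assms(3) by auto
  have "c < k"
    using assms(2) h V by (force simp: bij_betw_def)
  then have "{i. i < k \<and> {x, y, z} \<in> pair_graph V h i} = {c}"
    using triple_with_pair_in_pair_graph_iff[of x y z V h a r c t] assms(1) h ac ba s by auto
  then show ?thesis
    by simp
qed

lemma odd_card_pair_graph:
  assumes "e \<in> nsets V 3" "bij_betw h V ({..<k} \<times> UNIV)"
  shows "odd (card {i. i < k \<and> e \<in> pair_graph V h i})"
proof -
  obtain x y z where e: "e = {x, y, z}"
    using assms(1) by (auto simp: nsets_def card_3_iff)
  have im: "h ` V \<subseteq> {..<k} \<times> UNIV"
    using assms(2) by (auto simp: bij_betw_def)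
  have same: ?thesis if "e = {x', y', z'}" "fst (h x') = fst (h y')" for x' y' z'
    using odd_card_same_pair[OF _ assms(2), of x' y' z'] assms(1) that by simp
  have less: ?thesis if "e = {x', y', z'}" "fst (h x') < fst (h y')" "fst (h y') < fst (h z')"
    for x' y' z'
    using odd_card_distinct_pairs[OF _ im, of x' y' z'] assms(1) that by simp
  \<comment> \<open>The triple is unordered: either two indices agree or one of the six strict
    orders holds, and renaming reduces each case to \<open>same\<close> or
    \<open>less\<close>.\<close>
  consider "fst (h x) = fst (h y)" | "fst (h x) = fst (h z)" | "fst (h y) = fst (h z)"
    | "fst (h x) < fst (h y)" "fst (h y) < fst (h z)"
    | "fst (h x) < fst (h z)" "fst (h z) < fst (h y)"
    | "fst (h y) < fst (h x)" "fst (h x) < fst (h z)"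
    | "fst (h y) < fst (h z)" "fst (h z) < fst (h x)"
    | "fst (h z) < fst (h x)" "fst (h x) < fst (h y)"
    | "fst (h z) < fst (h y)" "fst (h y) < fst (h x)"
    by linarith
  then show ?thesis
  proof cases
    case 1 then show ?thesis using same[of x y z] e by blast
  next
    case 2 then show ?thesis using same[of x z y] e by blast
  next
    case 3 then show ?thesis using same[of y z x] e by blast
  next
    case 4 then show ?thesis using less[of x y z] e by blast
  next
    case 5 then show ?thesis using less[of x z y] e by blast
  next
    case 6 then show ?thesis using less[of y x z] e by blast
  next
    case 7 then show ?thesis using less[of y z x] e by blast
  next
    case 8 then show ?thesis using less[of z x y] e by blast
  next
    case 9 then show ?thesis using less[of z y x] e by blast
  qed
qed

text \<open>A cover is a set, so coinciding graphs would be counted once. The triple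
  \<open>u\<^sub>j, v\<^sub>j, u\<^sub>i\<close> tells graph \<open>i\<close> from graph
  \<open>j\<close>.\<close>

lemma inj_on_pair_graph:
  assumes "bij_betw h V ({..<k} \<times> UNIV)"
  shows "inj_on (pair_graph V h) {..<k}"
proof (rule inj_onI, rule ccontr)
  fix i j assume ij: "i \<in> {..<k}" "j \<in> {..<k}" "i \<noteq> j" and eq: "pair_graph V h i = pair_graph V h j"
  have "\<exists>x\<in>V. h x = p" if "p \<in> {..<k} \<times> UNIV" for p
    using assms that unfolding bij_betw_def by (metis imageE)
  then obtain x y z where V: "x \<in> V" "y \<in> V" "z \<in> V"
    and h: "h x = (j, True)" "h y = (j, False)" "h z = (i, True)"
    using ij by (metis SigmaI UNIV_I)
  have "distinct [x, y, z]"
    using h ij by auto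
  then have "{x, y, z} \<in> nsets V 3"
    using V by (auto simp: nsets_def)
  then have *: "{x, y, z} \<in> pair_graph V h l \<longleftrightarrow> l = i" for l
    using triple_with_pair_in_pair_graph_iff[of x y z V h j True i True] h ij by simp
  show False
    using *[of i] *[of j] eq ij by simp
qed

theorem theorem1:
  fixes V :: "'a set" and n :: nat
  assumes "finite V" and "card V = n" and "even n" and "n \<ge> 4"
  shows "\<exists>F. odd_cover V F \<and> card F = n div 2"
proof -
  define k where "k = n div 2"
  have "card V = card ({..<k} \<times> (UNIV :: bool set))"
    using assms by (simp add: k_def)
  then obtain h :: "'a \<Rightarrow> nat \<times> bool" where h: "bij_betw h V ({..<k} \<times> UNIV)"
    using finite_same_card_bij[OF assms(1)] by (metis finite_SigmaI finite_lessThan finite_UNIV)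
  note inj = inj_on_pair_graph[OF h]
  define F where "F = pair_graph V h ` {..<k}"
  have "odd (card {G \<in> F. e \<in> G})" if e: "e \<in> nsets V 3" for e
  proof -
    \<comment> \<open>By injectivity, counting graphs that contain \<open>e\<close> amounts to
      counting their indices.\<close>
    have "{G \<in> F. e \<in> G} = pair_graph V h ` {i. i < k \<and> e \<in> pair_graph V h i}"
      by (auto simp: F_def)
    moreover have "inj_on (pair_graph V h) {i. i < k \<and> e \<in> pair_graph V h i}"
      by (rule inj_on_subset[OF inj]) auto
    ultimately show ?thesis
      using odd_card_pair_graph[OF e h] by (simp add: card_image)
  qed
  then have "odd_cover V F"
    by (auto simp: odd_cover_def F_def complete_tripartite_pair_graph)
  moreover have "card F = n div 2"
    using card_image[OF inj] by (simp add: F_def k_def)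
  ultimately show ?thesis
    by blast
qed

end
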